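(* Let $R$ be a ring filtered by a set $\{U_i : i\in\mathbb N\}$ of additive subgroups. Suppose further that, for all $i\in\mathbb N$, $U_{i+1}/U_i$ is a free left $U_0$-module of rank $1$. Then $R$ satisfies the rank condition if and only if $U_0$ satisfies the rank condition.
   Context: Rings are associative and unital (not necessarily commutative). $\mathbb N=\{0,1,2,\dots\}$. A set $\{U_i:i\in\mathbb N\}$ of additive subgroups of a ring $R$ is a filtration of $R$ (and $R$ is said to be filtered by it) if: (i) $U_0\subseteq U_1\subseteq U_2\subseteq\cdots$; (ii) $U_iU_j\subseteq U_{i+j}$ for all $i,j\in\mathbb N$; (iii) $\bigcup_{i=0}^\infty U_i=R$; (iv) $1\in U_0$. In this case $U_0$ is a unital subring of $R$ and each $U_i$ is both a left and a right $U_0$-submodule of $R$. "Free of rank $k$" means having a basis with exactly $k$ elements, i.e. being isomorphic to $U_0^k$. A ring $R$ satisfies the rank condition if, for every positive integer $n$, there is no right $R$-module epimorphism $R^n\to R^{n+1}$ (equivalently, no left $R$-module epimorphism $R^n\to R^{n+1}$). *)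

theory Defs
  imports "HOL-Algebra.Module" "HOL-Algebra.AbelCoset" "HOL-Algebra.Subrings"
begin

(* HOL-Algebra's locale "module" requires a commutative ring of scalars, so modules over an
   arbitrary ring are introduced here. The record type "module" is reused; its "mult" and "one"
   fields play no role and are left undefined. *)

locale left_module = S?: ring S + M?: abelian_group M
  for S :: "('a, 'm) ring_scheme" (structure) and M :: "('a, 'b, 'n) module_scheme" (structure) +
  assumes smult_closed [simp, intro]:
      "\<lbrakk>a \<in> carrier S; x \<in> carrier M\<rbrakk> \<Longrightarrow> a \<odot>\<^bsub>M\<^esub> x \<in> carrier M"
    and smult_l_distr:
      "\<lbrakk>a \<in> carrier S; b \<in> carrier S; x \<in> carrier M\<rbrakk> \<Longrightarrow>
        (a \<oplus> b) \<odot>\<^bsub>M\<^esub> x = a \<odot>\<^bsub>M\<^esub> x \<oplus>\<^bsub>M\<^esub> b \<odot>\<^bsub>M\<^esub> x"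
    and smult_r_distr:
      "\<lbrakk>a \<in> carrier S; x \<in> carrier M; y \<in> carrier M\<rbrakk> \<Longrightarrow>
        a \<odot>\<^bsub>M\<^esub> (x \<oplus>\<^bsub>M\<^esub> y) = a \<odot>\<^bsub>M\<^esub> x \<oplus>\<^bsub>M\<^esub> a \<odot>\<^bsub>M\<^esub> y"
    and smult_assoc:
      "\<lbrakk>a \<in> carrier S; b \<in> carrier S; x \<in> carrier M\<rbrakk> \<Longrightarrow>
        (a \<otimes> b) \<odot>\<^bsub>M\<^esub> x = a \<odot>\<^bsub>M\<^esub> (b \<odot>\<^bsub>M\<^esub> x)"
    and smult_one [simp]:
      "x \<in> carrier M \<Longrightarrow> \<one> \<odot>\<^bsub>M\<^esub> x = x"

(* Bases are indexed families rather than sets, so that having a basis of k elements means being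
   isomorphic to S^k also when S is the zero ring. *)

definition is_left_basis ::
  "('a, 'm) ring_scheme \<Rightarrow> ('a, 'b, 'n) module_scheme \<Rightarrow> nat \<Rightarrow> (nat \<Rightarrow> 'b) \<Rightarrow> bool" where
  "is_left_basis S M k b \<longleftrightarrow>
     b \<in> {..<k} \<rightarrow> carrier M \<and>
     (\<forall>x \<in> carrier M. \<exists>!c. c \<in> {..<k} \<rightarrow>\<^sub>E carrier S \<and>
        x = (\<Oplus>\<^bsub>M\<^esub> i \<in> {..<k}. c i \<odot>\<^bsub>M\<^esub> b i))"

definition left_free_of_rank ::
  "('a, 'm) ring_scheme \<Rightarrow> ('a, 'b, 'n) module_scheme \<Rightarrow> nat \<Rightarrow> bool" where
  "left_free_of_rank S M k \<longleftrightarrow> left_module S M \<and> (\<exists>b. is_left_basis S M k b)"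

(* For a quotient by a submodule N, the product of a with the coset N + x is the coset N + a x. *)

definition quotient_module ::
  "('a, 'b, 'n) module_scheme \<Rightarrow> 'b set \<Rightarrow> ('a, 'b set) module" where
  "quotient_module M N =
     \<lparr>carrier = a_rcosets\<^bsub>M\<^esub> N, mult = undefined, one = undefined,
      zero = N, add = set_add M,
      smult = (\<lambda>a X. \<Union>x \<in> X. N +>\<^bsub>M\<^esub> (a \<odot>\<^bsub>M\<^esub> x))\<rparr>"

(* An additive subgroup of R on which scalars from a subring act by left multiplication. *)

definition left_mult_module :: "('a, 'm) ring_scheme \<Rightarrow> 'a set \<Rightarrow> ('a, 'a) module" where
  "left_mult_module R A =
     \<lparr>carrier = A, mult = undefined, one = undefined,
      zero = \<zero>\<^bsub>R\<^esub>, add = add R, smult = mult R\<rparr>"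

(* The right R-module R^n. Its "smult" is the right action: "smult a x" is x a. *)

definition right_power_module :: "('a, 'm) ring_scheme \<Rightarrow> nat \<Rightarrow> ('a, nat \<Rightarrow> 'a) module" where
  "right_power_module R n =
     \<lparr>carrier = {..<n} \<rightarrow>\<^sub>E carrier R, mult = undefined, one = undefined,
      zero = (\<lambda>i \<in> {..<n}. \<zero>\<^bsub>R\<^esub>),
      add = (\<lambda>x y. \<lambda>i \<in> {..<n}. x i \<oplus>\<^bsub>R\<^esub> y i),
      smult = (\<lambda>a x. \<lambda>i \<in> {..<n}. x i \<otimes>\<^bsub>R\<^esub> a)\<rparr>"

definition module_homs ::
  "('a, 'm) ring_scheme \<Rightarrow> ('a, 'b, 'n) module_scheme \<Rightarrow> ('a, 'c, 'p) module_scheme \<Rightarrow> ('b \<Rightarrow> 'c) set"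
  where
  "module_homs R M N =
     {f \<in> carrier M \<rightarrow> carrier N.
        (\<forall>x \<in> carrier M. \<forall>y \<in> carrier M. f (x \<oplus>\<^bsub>M\<^esub> y) = f x \<oplus>\<^bsub>N\<^esub> f y) \<and>
        (\<forall>a \<in> carrier R. \<forall>x \<in> carrier M. f (a \<odot>\<^bsub>M\<^esub> x) = a \<odot>\<^bsub>N\<^esub> f x)}"

definition module_epis ::
  "('a, 'm) ring_scheme \<Rightarrow> ('a, 'b, 'n) module_scheme \<Rightarrow> ('a, 'c, 'p) module_scheme \<Rightarrow> ('b \<Rightarrow> 'c) set"
  where
  "module_epis R M N = {f \<in> module_homs R M N. f ` carrier M = carrier N}"

definition rank_condition :: "('a, 'm) ring_scheme \<Rightarrow> bool" where
  "rank_condition R \<longleftrightarrow>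
     (\<forall>n > 0. module_epis R (right_power_module R n) (right_power_module R (n + 1)) = {})"

locale filtered_ring = ring R for R :: "('a, 'm) ring_scheme" (structure) and U :: "nat \<Rightarrow> 'a set" +
  assumes additive_subgroup: "additive_subgroup (U i) R"
    and incr: "U i \<subseteq> U (Suc i)"
    and mult_subset: "U i <#> U j \<subseteq> U (i + j)"
    and exhaustive: "(\<Union>i. U i) = carrier R"
    and one_mem: "\<one> \<in> U 0"

abbreviation subring_of :: "('a, 'm) ring_scheme \<Rightarrow> 'a set \<Rightarrow> ('a, 'm) ring_scheme" where
  "subring_of R A \<equiv> R\<lparr>carrier := A\<rparr>"

context filtered_ring
begin

lemma mult_mem: "\<lbrakk>x \<in> U i; y \<in> U j\<rbrakk> \<Longrightarrow> x \<otimes> y \<in> U (i + j)"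
  using mult_subset[of i j] by (auto simp: set_mult_def)

lemma carrier_mem: "x \<in> U i \<Longrightarrow> x \<in> carrier R"
  using exhaustive by auto

lemma subring_U0: "subring (U 0) R"
proof -
  interpret A: additive_subgroup "U 0" R by (rule additive_subgroup)
  show ?thesis
    using mult_mem[of _ 0 _ 0] one_mem A.a_subset by (intro subringI) auto
qed

lemma ring_U0: "ring (subring_of R (U 0))"
  by (rule subring_is_ring[OF subring_U0])

lemma abelian_group_U: "abelian_group (left_mult_module R (U i))"
proof -
  interpret A: additive_subgroup "U i" R by (rule additive_subgroup)
  have "\<exists>y \<in> U i. y \<oplus> x = \<zero>" if "x \<in> U i" for x
    using that by (intro bexI[of _ "\<ominus> x"]) (auto simp: carrier_mem l_neg)
  then show ?thesis
    by (intro abelian_groupI) (auto simp: left_mult_module_def carrier_mem a_ac)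
qed

lemma left_module_U: "left_module (subring_of R (U 0)) (left_mult_module R (U i))"
  using mult_mem[of _ 0 _ i]
  by (intro left_module.intro left_module_axioms.intro ring_U0 abelian_group_U)
    (auto simp: left_mult_module_def carrier_mem l_distr r_distr m_assoc)

end

lemma (in left_module) left_module_quotient:
  assumes N: "additive_subgroup N M"
    and closed: "\<And>a x. \<lbrakk>a \<in> carrier S; x \<in> N\<rbrakk> \<Longrightarrow> a \<odot>\<^bsub>M\<^esub> x \<in> N"
  shows "left_module S (quotient_module M N)"
proof -
  interpret N: abelian_subgroup N M
    by (rule abelian_subgroupI3[OF N M.abelian_group_axioms])
  have act: "(\<Union>x \<in> N +>\<^bsub>M\<^esub> m. N +>\<^bsub>M\<^esub> (a \<odot>\<^bsub>M\<^esub> x)) = N +>\<^bsub>M\<^esub> (a \<odot>\<^bsub>M\<^esub> m)"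
    if a: "a \<in> carrier S" and m: "m \<in> carrier M" for a m
  proof -
    have "N +>\<^bsub>M\<^esub> (a \<odot>\<^bsub>M\<^esub> x) = N +>\<^bsub>M\<^esub> (a \<odot>\<^bsub>M\<^esub> m)" if x: "x \<in> N +>\<^bsub>M\<^esub> m" for x
    proof -
      obtain h where h: "h \<in> N" "x = h \<oplus>\<^bsub>M\<^esub> m" using x by (auto simp: a_r_coset_def')
      then have "a \<odot>\<^bsub>M\<^esub> x = a \<odot>\<^bsub>M\<^esub> h \<oplus>\<^bsub>M\<^esub> a \<odot>\<^bsub>M\<^esub> m"
        using smult_r_distr[OF a _ m] N.a_subset by auto
      then have "a \<odot>\<^bsub>M\<^esub> x \<in> N +>\<^bsub>M\<^esub> (a \<odot>\<^bsub>M\<^esub> m)"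
        using closed[OF a h(1)] by (auto simp: a_r_coset_def')
      then show ?thesis
        using M.a_repr_independence[OF _ _ N.a_subgroup] a m by fastforce
    qed
    note eq = this
    have const: "\<And>A m f (c :: 'b set). \<lbrakk>m \<in> A; \<And>x. x \<in> A \<Longrightarrow> f x = c\<rbrakk> \<Longrightarrow> (\<Union>x \<in> A. f x) = c"
      by auto
    show ?thesis by (rule const[OF N.a_rcos_self[OF m] eq])
  qed
  have cos: "\<And>X. X \<in> a_rcosets\<^bsub>M\<^esub> N \<Longrightarrow> \<exists>m \<in> carrier M. X = N +>\<^bsub>M\<^esub> m"
    by (auto simp: A_RCOSETS_def')
  have sum: "\<And>x y. \<lbrakk>x \<in> carrier M; y \<in> carrier M\<rbrakk> \<Longrightarrow>
      (N +>\<^bsub>M\<^esub> x) <+>\<^bsub>M\<^esub> (N +>\<^bsub>M\<^esub> y) = N +>\<^bsub>M\<^esub> (x \<oplus>\<^bsub>M\<^esub> y)"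
    by (rule N.a_rcos_sum)
  have mem: "\<And>x. x \<in> carrier M \<Longrightarrow> N +>\<^bsub>M\<^esub> x \<in> a_rcosets\<^bsub>M\<^esub> N"
    by (rule M.a_rcosetsI[OF N.a_subset])
  have neg: "\<exists>Y \<in> a_rcosets\<^bsub>M\<^esub> N. Y <+>\<^bsub>M\<^esub> X = N" if X: "X \<in> a_rcosets\<^bsub>M\<^esub> N" for X
  proof -
    obtain m where m: "m \<in> carrier M" "X = N +>\<^bsub>M\<^esub> m" using cos[OF X] by blast
    have "(N +>\<^bsub>M\<^esub> (\<ominus>\<^bsub>M\<^esub> m)) <+>\<^bsub>M\<^esub> X = N"
      unfolding m(2) sum[OF M.a_inv_closed[OF m(1)] m(1)] M.l_neg[OF m(1)]
      by (rule M.a_coset_add_zero[OF N.a_subset])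
    then show ?thesis using mem[OF M.a_inv_closed[OF m(1)]] by blast
  qed
  have comm: "X <+>\<^bsub>M\<^esub> Y = Y <+>\<^bsub>M\<^esub> X"
    if X: "X \<in> a_rcosets\<^bsub>M\<^esub> N" and Y: "Y \<in> a_rcosets\<^bsub>M\<^esub> N" for X Y
  proof -
    obtain x y where xy: "x \<in> carrier M" "X = N +>\<^bsub>M\<^esub> x" "y \<in> carrier M" "Y = N +>\<^bsub>M\<^esub> y"
      using cos[OF X] cos[OF Y] by blast
    show ?thesis
      unfolding xy(2,4) sum[OF xy(1,3)] sum[OF xy(3,1)] M.a_comm[OF xy(1,3)] ..
  qed
  let ?Q = "quotient_module M N"
  have Q: "carrier ?Q = a_rcosets\<^bsub>M\<^esub> N" "add ?Q = set_add M" "zero ?Q = N"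
    by (simp_all add: quotient_module_def)
  have Qs: "a \<odot>\<^bsub>?Q\<^esub> (N +>\<^bsub>M\<^esub> m) = N +>\<^bsub>M\<^esub> (a \<odot>\<^bsub>M\<^esub> m)"
    if "a \<in> carrier S" "m \<in> carrier M" for a m
    using act[OF that] by (simp add: quotient_module_def)
  have "abelian_group ?Q"
    by (rule abelian_groupI; unfold Q)
      (rule N.a_setmult_closed N.a_subgroup_in_rcosets N.a_rcosets_assoc comm
        N.rcosets_add_eq neg; assumption)+
  moreover have "left_module_axioms S ?Q"
  proof (rule left_module_axioms.intro; unfold Q)
    fix a X assume a: "a \<in> carrier S" and X: "X \<in> a_rcosets\<^bsub>M\<^esub> N"
    obtain x where x: "x \<in> carrier M" "X = N +>\<^bsub>M\<^esub> x" using cos[OF X] by blast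
    show "a \<odot>\<^bsub>?Q\<^esub> X \<in> a_rcosets\<^bsub>M\<^esub> N"
      unfolding x(2) Qs[OF a x(1)] by (rule mem[OF smult_closed[OF a x(1)]])
  next
    fix X assume X: "X \<in> a_rcosets\<^bsub>M\<^esub> N"
    obtain x where x: "x \<in> carrier M" "X = N +>\<^bsub>M\<^esub> x" using cos[OF X] by blast
    show "\<one> \<odot>\<^bsub>?Q\<^esub> X = X"
      unfolding x(2) Qs[OF S.one_closed x(1)] smult_one[OF x(1)] ..
  next
    fix a b X assume a: "a \<in> carrier S" and b: "b \<in> carrier S" and X: "X \<in> a_rcosets\<^bsub>M\<^esub> N"
    obtain x where x: "x \<in> carrier M" "X = N +>\<^bsub>M\<^esub> x" using cos[OF X] by blast
    note ax = smult_closed[OF a x(1)] and bx = smult_closed[OF b x(1)]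
    show "(a \<oplus> b) \<odot>\<^bsub>?Q\<^esub> X = a \<odot>\<^bsub>?Q\<^esub> X <+>\<^bsub>M\<^esub> b \<odot>\<^bsub>?Q\<^esub> X"
      unfolding x(2) Qs[OF S.a_closed[OF a b] x(1)] Qs[OF a x(1)] Qs[OF b x(1)]
        sum[OF ax bx] smult_l_distr[OF a b x(1)] ..
    show "(a \<otimes> b) \<odot>\<^bsub>?Q\<^esub> X = a \<odot>\<^bsub>?Q\<^esub> (b \<odot>\<^bsub>?Q\<^esub> X)"
      unfolding x(2) Qs[OF S.m_closed[OF a b] x(1)] Qs[OF b x(1)] Qs[OF a bx]
        smult_assoc[OF a b x(1)] ..
  next
    fix a X Y assume a: "a \<in> carrier S" and X: "X \<in> a_rcosets\<^bsub>M\<^esub> N" and Y: "Y \<in> a_rcosets\<^bsub>M\<^esub> N"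
    obtain x y where xy: "x \<in> carrier M" "X = N +>\<^bsub>M\<^esub> x" "y \<in> carrier M" "Y = N +>\<^bsub>M\<^esub> y"
      using cos[OF X] cos[OF Y] by blast
    show "a \<odot>\<^bsub>?Q\<^esub> (X <+>\<^bsub>M\<^esub> Y) = a \<odot>\<^bsub>?Q\<^esub> X <+>\<^bsub>M\<^esub> a \<odot>\<^bsub>?Q\<^esub> Y"
      unfolding xy(2,4) sum[OF xy(1,3)] Qs[OF a M.a_closed[OF xy(1,3)]] Qs[OF a xy(1)]
        Qs[OF a xy(3)] sum[OF smult_closed[OF a xy(1)] smult_closed[OF a xy(3)]]
        smult_r_distr[OF a xy(1,3)] ..
  qed
  ultimately show ?thesis by (intro left_module.intro S.ring_axioms)
qed

lemma (in filtered_ring) left_module_factor: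
  "left_module (subring_of R (U 0)) (quotient_module (left_mult_module R (U (Suc i))) (U i))"
proof -
  interpret A: additive_subgroup "U i" R by (rule additive_subgroup)
  interpret L: left_module "subring_of R (U 0)" "left_mult_module R (U (Suc i))"
    by (rule left_module_U)
  have inv: "\<ominus>\<^bsub>left_mult_module R (U (Suc i))\<^esub> x = \<ominus> x" if "x \<in> U i" for x
    using that incr[of i]
    by (intro L.minus_equality) (auto simp: left_mult_module_def carrier_mem l_neg)
  have "additive_subgroup (U i) (left_mult_module R (U (Suc i)))"
  proof (intro additive_subgroupI subgroup.intro)
    fix x assume "x \<in> U i"
    then show "inv\<^bsub>add_monoid (left_mult_module R (U (Suc i)))\<^esub> x \<in> U i"
      using inv[of x] by (simp add: a_inv_def[symmetric])
  qed (use incr[of i] in \<open>auto simp: left_mult_module_def\<close>)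
  then show ?thesis
    by (rule L.left_module_quotient) (use mult_mem[of _ 0 _ i] in \<open>auto simp: left_mult_module_def\<close>)
qed

end

theory Submission
  imports Defs "Jordan_Normal_Form.Missing_Ring"
begin

text \<open>
  An epimorphism onto a free module splits, so a failure of the rank condition is a pair of
  matrices \<open>A\<close>, \<open>B\<close> with \<open>AB = 1\<close>, where \<open>A\<close> has more rows than columns. Such a pair over \<open>U\<^sub>0\<close>
  is one over \<open>R\<close>. Conversely, lifting generators of the factors \<open>U\<^bsub>i+1\<^esub>/U\<^sub>i\<close> gives elements
  \<open>b\<^sub>0 = 1, b\<^sub>1, b\<^sub>2, \<dots>\<close> such that \<open>b\<^sub>0, \<dots>, b\<^sub>i\<close> is a basis of the left \<open>U\<^sub>0\<close>-module \<open>U\<^sub>i\<close>. If the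
  entries of an \<open>(n+1) \<times> n\<close> matrix \<open>A\<close> over \<open>R\<close> and of its right inverse lie in \<open>U\<^sub>k\<close>, then right
  multiplication by \<open>A\<close> maps row vectors over \<open>U\<^sub>d\<close> to row vectors over \<open>U\<^bsub>d+k\<^esub>\<close>. It is a split
  monomorphism from a free \<open>U\<^sub>0\<close>-module of rank \<open>(n+1)(d+1)\<close> to one of rank \<open>n(d+k+1)\<close>, and the
  former rank exceeds the latter once \<open>d \<ge> nk\<close>.
\<close>

section \<open>Matrices with a right inverse\<close>

text \<open>Such an \<open>A\<close> is a split epimorphism of right modules from columns over
  \<open>J\<close> to columns over \<open>I\<close>, and equally, by right multiplication, a split
  monomorphism of left modules from rows over \<open>I\<close> to rows over \<open>J\<close>. The
  index sets are arbitrary so that pairs can later serve as indices of block matrices.\<close>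

definition split_epi :: "('a, 'm) ring_scheme \<Rightarrow> 'i set \<Rightarrow> 'j set \<Rightarrow> bool" where
  "split_epi S I J \<longleftrightarrow>
     (\<exists>A B. (\<forall>i\<in>I. \<forall>j\<in>J. A i j \<in> carrier S \<and> B j i \<in> carrier S) \<and>
       (\<forall>i\<in>I. \<forall>k\<in>I. (\<Oplus>\<^bsub>S\<^esub>j\<in>J. A i j \<otimes>\<^bsub>S\<^esub> B j k) = (if i = k then \<one>\<^bsub>S\<^esub> else \<zero>\<^bsub>S\<^esub>)))"

lemma split_epiI:
  assumes "\<And>i j. \<lbrakk>i \<in> I; j \<in> J\<rbrakk> \<Longrightarrow> A i j \<in> carrier S"
    and "\<And>i j. \<lbrakk>i \<in> I; j \<in> J\<rbrakk> \<Longrightarrow> B j i \<in> carrier S"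
    and "\<And>i k. \<lbrakk>i \<in> I; k \<in> I\<rbrakk> \<Longrightarrow>
      (\<Oplus>\<^bsub>S\<^esub>j\<in>J. A i j \<otimes>\<^bsub>S\<^esub> B j k) = (if i = k then \<one>\<^bsub>S\<^esub> else \<zero>\<^bsub>S\<^esub>)"
  shows "split_epi S I J"
  unfolding split_epi_def using assms by blast

lemma split_epiE:
  assumes "split_epi S I J"
  obtains A B where "\<forall>i\<in>I. \<forall>j\<in>J. A i j \<in> carrier S" "\<forall>i\<in>I. \<forall>j\<in>J. B j i \<in> carrier S"
    "\<forall>i\<in>I. \<forall>k\<in>I. (\<Oplus>\<^bsub>S\<^esub>j\<in>J. A i j \<otimes>\<^bsub>S\<^esub> B j k) = (if i = k then \<one>\<^bsub>S\<^esub> else \<zero>\<^bsub>S\<^esub>)"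
  using assms unfolding split_epi_def by blast

text \<open>Omitting rows of \<open>A\<close> together with the same columns of \<open>B\<close>
  leaves a smaller identity matrix, whose diagonal is recognised by the injectivity of
  \<open>g\<close>. The inner index is summed over, so it may only be relabelled, whence the
  bijection \<open>h\<close>.\<close>

lemma (in ring) split_epi_reindex:
  assumes "split_epi R I J" and g: "inj_on g I'" "g ` I' \<subseteq> I" and h: "bij_betw h J' J"
  shows "split_epi R I' J'"
proof -
  obtain A B where *: "\<forall>i\<in>I. \<forall>j\<in>J. A i j \<in> carrier R" "\<forall>i\<in>I. \<forall>j\<in>J. B j i \<in> carrier R"
    "\<forall>i\<in>I. \<forall>k\<in>I. (\<Oplus>j\<in>J. A i j \<otimes> B j k) = (if i = k then \<one> else \<zero>)"
    using assms(1) by (rule split_epiE)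
  note A = *(1)[rule_format] and B = *(2)[rule_format] and AB = *(3)[rule_format]
  have hJ: "h ` J' = J" "inj_on h J'" using h by (auto simp: bij_betw_def)
  show ?thesis
  proof (rule split_epiI)
    fix i k assume ik: "i \<in> I'" "k \<in> I'"
    then have m: "g i \<in> I" "g k \<in> I" using g by auto
    have "(\<Oplus>j\<in>J'. A (g i) (h j) \<otimes> B (h j) (g k)) = (\<Oplus>j\<in>h ` J'. A (g i) j \<otimes> B j (g k))"
      using A B m hJ by (intro finsum_reindex[symmetric]) auto
    then show "(\<Oplus>j\<in>J'. A (g i) (h j) \<otimes> B (h j) (g k)) = (if i = k then \<one> else \<zero>)"
      using AB[OF m] hJ inj_onD[OF g(1) _ ik] by auto
  qed (use A B g hJ in auto)
qed

section \<open>Homomorphisms between free right modules as matrices\<close>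

lemma carrier_right_power_module [simp]:
  "carrier (right_power_module R n) = {..<n} \<rightarrow>\<^sub>E carrier R"
  by (simp add: right_power_module_def)

text \<open>The columns of \<open>A\<close> are the images of the standard basis vectors; since
  scalars act on the right, the entries of \<open>A\<close> multiply from the left. Surjectivity
  does not enter.\<close>

lemma (in ring) module_epi_matrix:
  assumes f: "f \<in> module_homs R (right_power_module R n) (right_power_module R m)"
  obtains A where "\<And>i j. \<lbrakk>i < m; j < n\<rbrakk> \<Longrightarrow> A i j \<in> carrier R"
    and "\<And>x i. \<lbrakk>x \<in> {..<n} \<rightarrow>\<^sub>E carrier R; i < m\<rbrakk> \<Longrightarrow> f x i = (\<Oplus>j\<in>{..<n}. A i j \<otimes> x j)"
proof -
  \<comment> \<open>The column with \<open>a\<close> in position \<open>j\<close> and zero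
    elsewhere; for \<open>j\<close> outside the range it is the zero column.\<close>
  define e where "e j a = (\<lambda>i\<in>{..<n}. if i = j then a else \<zero>)" for j :: nat and a
  let ?M = "right_power_module R n" and ?N = "right_power_module R m"
  have e [simp]: "e j a \<in> {..<n} \<rightarrow>\<^sub>E carrier R" if "a \<in> carrier R" for j a
    using that by (auto simp: e_def)
  have fc: "f x \<in> {..<m} \<rightarrow>\<^sub>E carrier R" if "x \<in> {..<n} \<rightarrow>\<^sub>E carrier R" for x
    using f that by (auto simp: module_homs_def)
  have fa: "f (\<lambda>i\<in>{..<n}. x i \<oplus> y i) = (\<lambda>i\<in>{..<m}. f x i \<oplus> f y i)"
    if "x \<in> {..<n} \<rightarrow>\<^sub>E carrier R" "y \<in> {..<n} \<rightarrow>\<^sub>E carrier R" for x y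
    using f that by (simp add: module_homs_def right_power_module_def)
  have fs: "f (\<lambda>i\<in>{..<n}. x i \<otimes> a) = (\<lambda>i\<in>{..<m}. f x i \<otimes> a)"
    if "x \<in> {..<n} \<rightarrow>\<^sub>E carrier R" "a \<in> carrier R" for x a
    using f that by (simp add: module_homs_def right_power_module_def)
  have Ac: "f (e j \<one>) i \<in> carrier R" if "i < m" for i j
    using fc[OF e[OF one_closed, of j]] that by auto
  have fe: "f (e j a) i = f (e j \<one>) i \<otimes> a" if "i < m" "a \<in> carrier R" for i j a
  proof -
    have "e j a = (\<lambda>i\<in>{..<n}. e j \<one> i \<otimes> a)" using that by (auto simp: e_def fun_eq_iff)
    then show ?thesis using fs[of "e j \<one>" a] that by simp
  qed
  have f0: "f (\<lambda>i\<in>{..<n}. \<zero>) i = \<zero>" if "i < m" for i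
  proof -
    have "(\<lambda>i\<in>{..<n}. \<zero>) = e n \<zero>" by (auto simp: e_def)
    then show ?thesis using fe[OF that, of \<zero> n] Ac[OF that] by simp
  qed
  \<comment> \<open>Induction on the number \<open>k\<close> of leading coordinates of
    \<open>x\<close> that may be non-zero; the case \<open>k = n\<close> is the full
    expansion.\<close>
  have "f x i = (\<Oplus>j\<in>{..<k}. f (e j \<one>) i \<otimes> x j)"
    if "k \<le> n" "x \<in> {..<n} \<rightarrow>\<^sub>E carrier R" "\<And>j. \<lbrakk>k \<le> j; j < n\<rbrakk> \<Longrightarrow> x j = \<zero>" "i < m" for k x i
    using that
  proof (induction k arbitrary: x)
    case 0
    then have "x = (\<lambda>i\<in>{..<n}. \<zero>)" by (fastforce simp: fun_eq_iff PiE_iff extensional_def)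
    then show ?case using f0[OF \<open>i < m\<close>] by (simp del: restrict_apply)
  next
    case (Suc k)
    \<comment> \<open>Clearing coordinate \<open>k\<close> makes the induction hypothesis applicable
      to \<open>y\<close>, and \<open>x\<close> is the sum of \<open>y\<close> and the column
      \<open>e k (x k)\<close>.\<close>
    define y where "y = x(k := \<zero>)"
    have xc: "x j \<in> carrier R" if "j < n" for j using Suc.prems(2) that by auto
    have y: "y \<in> {..<n} \<rightarrow>\<^sub>E carrier R"
      using Suc.prems(1,2) by (auto simp: y_def PiE_iff extensional_def)
    have x_eq: "x = (\<lambda>i\<in>{..<n}. y i \<oplus> e k (x k) i)"
    proof
      fix j show "x j = (\<lambda>i\<in>{..<n}. y i \<oplus> e k (x k) i) j"
        using Suc.prems(1,2) xc by (cases "j < n") (auto simp: y_def e_def PiE_iff extensional_def)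
    qed
    have k: "k < n" using Suc.prems(1) by simp
    have "f x i = f (\<lambda>i\<in>{..<n}. y i \<oplus> e k (x k) i) i" using x_eq by (rule arg_cong)
    also have "\<dots> = f y i \<oplus> f (e k (x k)) i"
      unfolding fa[OF y e[OF xc[OF k]]] using Suc.prems(4) by simp
    also have "f (e k (x k)) i = f (e k \<one>) i \<otimes> x k"
      by (rule fe[OF Suc.prems(4) xc[OF k]])
    also have "f y i = (\<Oplus>j\<in>{..<k}. f (e j \<one>) i \<otimes> y j)"
    proof (rule Suc.IH[OF _ y _ Suc.prems(4)])
      fix j assume "k \<le> j" "j < n"
      then show "y j = \<zero>" using Suc.prems(3)[of j] by (cases "j = k") (simp_all add: y_def)
    qed (use k in simp)
    also have "\<dots> = (\<Oplus>j\<in>{..<k}. f (e j \<one>) i \<otimes> x j)"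
      using k xc Ac[OF Suc.prems(4)] by (intro finsum_cong') (auto simp: y_def)
    also have "\<dots> \<oplus> f (e k \<one>) i \<otimes> x k = (\<Oplus>j\<in>{..<Suc k}. f (e j \<one>) i \<otimes> x j)"
      using k xc Ac[OF Suc.prems(4)]
      by (subst lessThan_Suc, subst finsum_insert) (auto intro!: a_comm finsum_closed)
    finally show ?case .
  qed
  note expand = this
  show thesis
  proof (rule that)
    show "f (e j \<one>) i \<in> carrier R" if "i < m" "j < n" for i j
      by (rule Ac[OF that(1)])
    show "f x i = (\<Oplus>j\<in>{..<n}. f (e j \<one>) i \<otimes> x j)"
      if "x \<in> {..<n} \<rightarrow>\<^sub>E carrier R" "i < m" for x i
      by (rule expand[OF order_refl that(1) _ that(2)]) (simp add: leD)
  qed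
qed

text \<open>Associativity of the product of a row, a matrix and a column: distribute, then
  interchange the two sums.\<close>

lemma (in ring) finsum_assoc_matrix:
  assumes "finite I" "finite J"
    and "\<And>i. i \<in> I \<Longrightarrow> a i \<in> carrier R" "\<And>i j. \<lbrakk>i \<in> I; j \<in> J\<rbrakk> \<Longrightarrow> b i j \<in> carrier R"
    and "\<And>j. j \<in> J \<Longrightarrow> c j \<in> carrier R"
  shows "(\<Oplus>i\<in>I. a i \<otimes> (\<Oplus>j\<in>J. b i j \<otimes> c j)) = (\<Oplus>j\<in>J. (\<Oplus>i\<in>I. a i \<otimes> b i j) \<otimes> c j)"
proof -
  have "(\<Oplus>i\<in>I. a i \<otimes> (\<Oplus>j\<in>J. b i j \<otimes> c j)) = (\<Oplus>i\<in>I. \<Oplus>j\<in>J. a i \<otimes> b i j \<otimes> c j)"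
    using assms by (intro finsum_cong') (auto simp: finsum_rdistr m_assoc Pi_def intro!: finsum_cong')
  also have "\<dots> = (\<Oplus>j\<in>J. \<Oplus>i\<in>I. a i \<otimes> b i j \<otimes> c j)"
    using assms by (intro finsum_finsum_swap) auto
  also have "\<dots> = (\<Oplus>j\<in>J. (\<Oplus>i\<in>I. a i \<otimes> b i j) \<otimes> c j)"
    using assms by (intro finsum_cong') (auto simp: finsum_ldistr Pi_def)
  finally show ?thesis .
qed

lemma (in ring) finsum_delta_mult:
  assumes "finite I" "k \<in> I" "\<And>i. i \<in> I \<Longrightarrow> x i \<in> carrier R"
  shows "(\<Oplus>i\<in>I. (if k = i then \<one> else \<zero>) \<otimes> x i) = x k"
proof -
  have "(\<Oplus>i\<in>I. (if k = i then \<one> else \<zero>) \<otimes> x i) = (\<Oplus>i\<in>I. if k = i then x i else \<zero>)"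
    using assms by (intro finsum_cong') auto
  then show ?thesis using finsum_singleton[of k I x] assms by simp
qed

text \<open>The target is free, so an epimorphism is split by choosing preimages of the unit
  vectors. Conversely, \<open>AB = 1\<close> shows that \<open>By\<close> is a preimage of
  \<open>y\<close> under multiplication by \<open>A\<close>.\<close>

lemma (in ring) module_epis_iff_split_epi:
  "module_epis R (right_power_module R n) (right_power_module R m) \<noteq> {} \<longleftrightarrow>
     split_epi R {..<m} {..<n}"
proof
  assume "module_epis R (right_power_module R n) (right_power_module R m) \<noteq> {}"
  then obtain f where f: "f \<in> module_homs R (right_power_module R n) (right_power_module R m)"
    and surj: "f ` ({..<n} \<rightarrow>\<^sub>E carrier R) = {..<m} \<rightarrow>\<^sub>E carrier R"
    by (auto simp: module_epis_def)
  obtain A where A: "\<And>i j. \<lbrakk>i < m; j < n\<rbrakk> \<Longrightarrow> A i j \<in> carrier R"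
    and fA: "\<And>x i. \<lbrakk>x \<in> {..<n} \<rightarrow>\<^sub>E carrier R; i < m\<rbrakk> \<Longrightarrow> f x i = (\<Oplus>j\<in>{..<n}. A i j \<otimes> x j)"
    using module_epi_matrix[OF f] by blast
  \<comment> \<open>The preimages found here become the columns of the right inverse, so its entry
    in row \<open>j\<close> and column \<open>k\<close> is \<open>X k j\<close> below. For
    \<open>k\<close> at least \<open>m\<close> the target is the zero vector, hence no bound on
    \<open>k\<close> is required.\<close>
  have "\<exists>x \<in> {..<n} \<rightarrow>\<^sub>E carrier R. f x = (\<lambda>i\<in>{..<m}. if i = k then \<one> else \<zero>)" for k
  proof -
    have "(\<lambda>i\<in>{..<m}. if i = k then \<one> else \<zero>) \<in> f ` ({..<n} \<rightarrow>\<^sub>E carrier R)"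
      unfolding surj by auto
    then show ?thesis by force
  qed
  then have "\<forall>k. \<exists>x. x \<in> {..<n} \<rightarrow>\<^sub>E carrier R \<and> f x = (\<lambda>i\<in>{..<m}. if i = k then \<one> else \<zero>)"
    by blast
  from choice[OF this] obtain X where X: "\<And>k. X k \<in> {..<n} \<rightarrow>\<^sub>E carrier R"
    and fX: "\<And>k. f (X k) = (\<lambda>i\<in>{..<m}. if i = k then \<one> else \<zero>)" by blast
  show "split_epi R {..<m} {..<n}"
  proof (rule split_epiI)
    fix i k assume "i \<in> {..<m}" "k \<in> {..<m}"
    then show "(\<Oplus>j\<in>{..<n}. A i j \<otimes> X k j) = (if i = k then \<one> else \<zero>)"
      using fA[OF X, of i k] by (simp add: fX)
  next
    fix i j assume "i \<in> {..<m}" "j \<in> {..<n}"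
    then show "A i j \<in> carrier R" "X i j \<in> carrier R" using A PiE_mem[OF X] by simp_all
  qed
next
  assume "split_epi R {..<m} {..<n}"
  then obtain A B where *: "\<forall>i\<in>{..<m}. \<forall>j\<in>{..<n}. A i j \<in> carrier R"
    "\<forall>i\<in>{..<m}. \<forall>j\<in>{..<n}. B j i \<in> carrier R"
    "\<forall>i\<in>{..<m}. \<forall>k\<in>{..<m}. (\<Oplus>j\<in>{..<n}. A i j \<otimes> B j k) = (if i = k then \<one> else \<zero>)"
    by (rule split_epiE)
  note A = *(1)[rule_format] and B = *(2)[rule_format] and AB = *(3)[rule_format]
  define f where "f x = (\<lambda>i\<in>{..<m}. \<Oplus>j\<in>{..<n}. A i j \<otimes> x j)" for x
  have fc: "f x \<in> {..<m} \<rightarrow>\<^sub>E carrier R" if "x \<in> {..<n} \<rightarrow>\<^sub>E carrier R" for x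
    using that A by (auto simp: f_def PiE_iff intro!: finsum_closed)
  have fa: "f (\<lambda>i\<in>{..<n}. x i \<oplus> y i) = (\<lambda>i\<in>{..<m}. f x i \<oplus> f y i)"
    if "x \<in> {..<n} \<rightarrow>\<^sub>E carrier R" "y \<in> {..<n} \<rightarrow>\<^sub>E carrier R" for x y
  proof (unfold f_def[of "\<lambda>i\<in>{..<n}. x i \<oplus> y i"], rule restrict_ext)
    fix i assume i: "i \<in> {..<m}"
    have "(\<Oplus>j\<in>{..<n}. A i j \<otimes> (\<lambda>i\<in>{..<n}. x i \<oplus> y i) j)
        = (\<Oplus>j\<in>{..<n}. A i j \<otimes> x j \<oplus> A i j \<otimes> y j)"
      using that i A by (intro finsum_cong') (auto simp: PiE_iff r_distr)
    also have "\<dots> = (\<Oplus>j\<in>{..<n}. A i j \<otimes> x j) \<oplus> (\<Oplus>j\<in>{..<n}. A i j \<otimes> y j)"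
      using that i A by (intro finsum_addf) (auto simp: PiE_iff)
    finally show "(\<Oplus>j\<in>{..<n}. A i j \<otimes> (\<lambda>i\<in>{..<n}. x i \<oplus> y i) j) = f x i \<oplus> f y i"
      using i by (simp add: f_def)
  qed
  have fs: "f (\<lambda>i\<in>{..<n}. x i \<otimes> a) = (\<lambda>i\<in>{..<m}. f x i \<otimes> a)"
    if "x \<in> {..<n} \<rightarrow>\<^sub>E carrier R" "a \<in> carrier R" for x a
  proof (unfold f_def[of "\<lambda>i\<in>{..<n}. x i \<otimes> a"], rule restrict_ext)
    fix i assume i: "i \<in> {..<m}"
    have "(\<Oplus>j\<in>{..<n}. A i j \<otimes> (\<lambda>i\<in>{..<n}. x i \<otimes> a) j) = (\<Oplus>j\<in>{..<n}. A i j \<otimes> x j \<otimes> a)"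
      using that i A by (intro finsum_cong') (auto simp: PiE_iff m_assoc)
    also have "\<dots> = (\<Oplus>j\<in>{..<n}. A i j \<otimes> x j) \<otimes> a"
      using that i A by (intro finsum_ldistr[symmetric]) (auto simp: PiE_iff)
    finally show "(\<Oplus>j\<in>{..<n}. A i j \<otimes> (\<lambda>i\<in>{..<n}. x i \<otimes> a) j) = f x i \<otimes> a"
      using i by (simp add: f_def)
  qed
  have surj: "y \<in> f ` ({..<n} \<rightarrow>\<^sub>E carrier R)" if y: "y \<in> {..<m} \<rightarrow>\<^sub>E carrier R" for y
  proof
    let ?x = "\<lambda>j\<in>{..<n}. \<Oplus>k\<in>{..<m}. B j k \<otimes> y k"
    show "?x \<in> {..<n} \<rightarrow>\<^sub>E carrier R" using B y by (auto simp: PiE_iff intro!: finsum_closed)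
    show "y = f ?x"
    proof
      fix i
      show "y i = f ?x i"
      proof (cases "i < m")
        case True
        have "f ?x i = (\<Oplus>j\<in>{..<n}. A i j \<otimes> (\<Oplus>k\<in>{..<m}. B j k \<otimes> y k))"
          using True A B y by (auto simp: f_def PiE_iff intro!: finsum_cong')
        also have "\<dots> = (\<Oplus>k\<in>{..<m}. (\<Oplus>j\<in>{..<n}. A i j \<otimes> B j k) \<otimes> y k)"
          using True A B y by (intro finsum_assoc_matrix) (auto simp: PiE_iff)
        also have "\<dots> = (\<Oplus>k\<in>{..<m}. (if i = k then \<one> else \<zero>) \<otimes> y k)"
          using True AB y by (intro finsum_cong') (auto simp: PiE_iff)
        also have "\<dots> = y i" using True y by (intro finsum_delta_mult) (auto simp: PiE_iff)
        finally show ?thesis ..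
      qed (use y in \<open>auto simp: f_def PiE_iff extensional_def\<close>)
    qed
  qed
  have "f \<in> module_homs R (right_power_module R n) (right_power_module R m)"
    unfolding module_homs_def
  proof (intro CollectI conjI ballI)
    show "f \<in> carrier (right_power_module R n) \<rightarrow> carrier (right_power_module R m)"
      unfolding carrier_right_power_module by (rule Pi_I) (rule fc)
  qed (simp_all add: right_power_module_def fa fs)
  moreover have "f ` ({..<n} \<rightarrow>\<^sub>E carrier R) = {..<m} \<rightarrow>\<^sub>E carrier R"
    by (intro equalityI subsetI; (elim imageE)?) (simp_all only: fc surj)
  ultimately have "f \<in> module_epis R (right_power_module R n) (right_power_module R m)"
    by (simp only: module_epis_def carrier_right_power_module mem_Collect_eq simp_thms)
  then show "module_epis R (right_power_module R n) (right_power_module R m) \<noteq> {}" by blast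
qed

section \<open>The rank condition in terms of matrices\<close>

lemma (in ring) rank_condition_iff_split_epi:
  "rank_condition R \<longleftrightarrow> (\<forall>n>0. \<not> split_epi R {..<n + 1} {..<n :: nat})"
  unfolding rank_condition_def module_epis_iff_split_epi[symmetric] by blast

text \<open>The rank condition only compares \<open>n + 1\<close> with \<open>n\<close>. A larger
  excess of rows reduces to this by keeping just \<open>card J + 1\<close> of them; \<open>J\<close>
  must be non-empty because the condition concerns positive \<open>n\<close>.\<close>

lemma (in ring) rank_condition_not_split_epi:
  assumes "rank_condition R" "finite I" "finite J" "J \<noteq> {}" "card J < card I"
  shows "\<not> split_epi R I J"
proof
  assume *: "split_epi R I J"
  obtain h where h: "bij_betw h {..<card J} J"
    using ex_bij_betw_nat_finite[OF assms(3)] by (auto simp: atLeast0LessThan)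
  obtain g where g: "bij_betw g {..<card I} I"
    using ex_bij_betw_nat_finite[OF assms(2)] by (auto simp: atLeast0LessThan)
  have "split_epi R {..<card J + 1} {..<card J}"
  proof (rule split_epi_reindex[OF * _ _ h])
    have "{..<card J + 1} \<subseteq> {..<card I}" using assms(5) by auto
    then show "inj_on g {..<card J + 1}" "g ` {..<card J + 1} \<subseteq> I"
      using g by (auto simp: bij_betw_def intro: inj_on_subset)
  qed
  moreover have "card J > 0" using assms by (simp add: card_gt_0_iff)
  ultimately show False using assms(1) unfolding rank_condition_iff_split_epi by blast
qed

section \<open>Matrices over a subring\<close>

lemma (in ring) finsum_subring:
  assumes "subring H R" "f \<in> I \<rightarrow> H"
  shows "(\<Oplus>\<^bsub>R\<lparr>carrier := H\<rparr>\<^esub>i\<in>I. f i) = (\<Oplus>i\<in>I. f i)"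
proof -
  interpret H: ring "R\<lparr>carrier := H\<rparr>" by (rule subring_is_ring[OF assms(1)])
  show ?thesis using assms(2)
  \<comment> \<open>For infinite \<open>I\<close> both sums take the default value zero, which the
    two rings share.\<close>
  proof (induction I rule: infinite_finite_induct)
    case (insert i I)
    then have "f i \<in> H" "f \<in> I \<rightarrow> H" "f \<in> I \<rightarrow> carrier R" "f i \<in> carrier R"
      using subringE(1)[OF assms(1)] by auto
    then show ?case using insert by simp
  qed simp_all
qed

lemma (in ring) split_epi_subring:
  assumes "subring H R" "split_epi (R\<lparr>carrier := H\<rparr>) I J"
  shows "split_epi R I J"
proof -
  let ?H = "R\<lparr>carrier := H\<rparr>"
  obtain A B where *: "\<forall>i\<in>I. \<forall>j\<in>J. A i j \<in> carrier ?H" "\<forall>i\<in>I. \<forall>j\<in>J. B j i \<in> carrier ?H"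
    "\<forall>i\<in>I. \<forall>k\<in>I. (\<Oplus>\<^bsub>?H\<^esub>j\<in>J. A i j \<otimes>\<^bsub>?H\<^esub> B j k) = (if i = k then \<one>\<^bsub>?H\<^esub> else \<zero>\<^bsub>?H\<^esub>)"
    using assms(2) by (rule split_epiE)
  note A = *(1)[rule_format, simplified] and B = *(2)[rule_format, simplified]
    and AB = *(3)[rule_format]
  show ?thesis
  proof (rule split_epiI)
    fix i k assume ik: "i \<in> I" "k \<in> I"
    have "(\<lambda>j. A i j \<otimes> B j k) \<in> J \<rightarrow> H"
      using A B ik subringE(6)[OF assms(1)] by auto
    from finsum_subring[OF assms(1) this] AB[OF ik]
    show "(\<Oplus>j\<in>J. A i j \<otimes> B j k) = (if i = k then \<one> else \<zero>)" by simp
  qed (use A B subringE(1)[OF assms(1)] in auto)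
qed

section \<open>Filtrations and generators of their factors\<close>

lemma (in filtered_ring) U_mono: "i \<le> j \<Longrightarrow> U i \<subseteq> U j"
  by (rule lift_Suc_mono_le[of U, OF incr])

lemma (in filtered_ring) finsum_mem:
  assumes "f \<in> I \<rightarrow> U i"
  shows "(\<Oplus>j\<in>I. f j) \<in> U i"
proof -
  interpret A: additive_subgroup "U i" R by (rule additive_subgroup)
  show ?thesis using assms
  proof (induction I rule: infinite_finite_induct)
    case (insert j I)
    then have "f j \<in> U i" "f \<in> I \<rightarrow> carrier R" "f j \<in> carrier R"
      using carrier_mem by auto
    then show ?case using insert by simp
  qed simp_all
qed

lemma (in filtered_ring) finite_subset_U:
  assumes "finite F" "F \<subseteq> carrier R"
  shows "\<exists>k. F \<subseteq> U k"
  using assms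
proof (induction F rule: finite_induct)
  case (insert x F)
  have "x \<in> (\<Union>i. U i)" using insert.prems exhaustive by simp
  then obtain l where "x \<in> U l" by blast
  moreover obtain k where "F \<subseteq> U k" using insert by auto
  ultimately have "insert x F \<subseteq> U (max k l)" using U_mono[of k "max k l"] U_mono[of l "max k l"] by auto
  then show ?case ..
qed simp

text \<open>Restates freeness of rank 1 without cosets: \<open>b\<close> represents the basis coset,
  and \<open>a\<close> is the coordinate of the coset of \<open>x\<close>, to be thought of as the
  leading coefficient of \<open>x\<close>.\<close>

lemma (in filtered_ring) quotient_generator:
  assumes free: "left_free_of_rank (subring_of R (U 0))
    (quotient_module (left_mult_module R (U (Suc i))) (U i)) 1"
  shows "\<exists>b \<in> U (Suc i). \<forall>x \<in> U (Suc i). \<exists>!a. a \<in> U 0 \<and> x \<ominus> a \<otimes> b \<in> U i"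
proof -
  let ?M = "left_mult_module R (U (Suc i))"
  let ?Q = "quotient_module ?M (U i)"
  interpret Q: left_module "subring_of R (U 0)" ?Q
    using free by (simp add: left_free_of_rank_def)
  interpret N: abelian_subgroup "U i" R
    by (rule abelian_subgroupI3[OF additive_subgroup abelian_group_axioms])
  obtain \<beta> where \<beta>: "is_left_basis (subring_of R (U 0)) ?Q 1 \<beta>"
    using free by (auto simp: left_free_of_rank_def)
  have coset: "U i +>\<^bsub>?M\<^esub> x = U i +> x" for x
    by (simp add: a_r_coset_def' left_mult_module_def)
  have carrier_Q: "carrier ?Q = (\<lambda>x. U i +> x) ` U (Suc i)"
    by (auto simp: quotient_module_def A_RCOSETS_def' coset left_mult_module_def a_r_coset_def')
  have \<beta>0: "\<beta> 0 \<in> carrier ?Q" using \<beta> by (auto simp: is_left_basis_def)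
  then obtain b where b: "b \<in> U (Suc i)" "\<beta> 0 = U i +> b" using carrier_Q by auto
  \<comment> \<open>The action on a coset is a union over its members \<open>z\<close>. All cosets
    in this union coincide, because \<open>a\<close> times an element of \<open>U i\<close> stays in
    \<open>U i\<close>.\<close>
  have smult: "a \<odot>\<^bsub>?Q\<^esub> \<beta> 0 = U i +> a \<otimes> b" if a: "a \<in> U 0" for a
  proof -
    have "U i +> a \<otimes> z = U i +> a \<otimes> b" if z: "z \<in> U i +> b" for z
    proof -
      obtain h where h: "h \<in> U i" "z = h \<oplus> b" using z by (auto simp: a_r_coset_def')
      then have "a \<otimes> z = a \<otimes> h \<oplus> a \<otimes> b" using a b carrier_mem by (simp add: r_distr)
      then have "a \<otimes> z \<in> U i +> a \<otimes> b"
        using mult_mem[OF a h(1)] by (auto simp: a_r_coset_def')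
      then show ?thesis
        using N.a_repr_independence' a b carrier_mem by (metis m_closed)
    qed
    moreover have "b \<in> U i +> b" using b carrier_mem by (intro N.a_rcos_self) auto
    ultimately have "(\<Union>z \<in> U i +> b. U i +> a \<otimes> z) = U i +> a \<otimes> b" by blast
    then show ?thesis
      by (simp add: quotient_module_def coset b(2)) (simp add: left_mult_module_def)
  qed
  have sum: "(\<Oplus>\<^bsub>?Q\<^esub>j \<in> {..<1}. c j \<odot>\<^bsub>?Q\<^esub> \<beta> j) = U i +> c 0 \<otimes> b" if "c 0 \<in> U 0" for c
    using Q.smult_closed[of "c 0" "\<beta> 0"] \<beta>0 smult[OF that] that by (simp add: lessThan_Suc)
  have eq_iff: "U i +> x = U i +> a \<otimes> b \<longleftrightarrow> x \<ominus> a \<otimes> b \<in> U i"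
    if "x \<in> U (Suc i)" "a \<in> U 0" for x a
  proof -
    have xa: "x \<in> carrier R" "a \<otimes> b \<in> carrier R" using that b carrier_mem by auto
    then have "U i +> x = U i +> a \<otimes> b \<longleftrightarrow> x \<in> U i +> a \<otimes> b"
      using N.a_repr_independence' N.a_rcos_self by metis
    then show ?thesis using N.a_rcos_module_minus[OF ring_axioms] xa by simp
  qed
  have "\<exists>!a. a \<in> U 0 \<and> x \<ominus> a \<otimes> b \<in> U i" if x: "x \<in> U (Suc i)" for x
  proof -
    have "U i +> x \<in> carrier ?Q" using x carrier_Q by auto
    then have "\<exists>!c. c \<in> {..<1} \<rightarrow>\<^sub>E U 0 \<and>
        U i +> x = (\<Oplus>\<^bsub>?Q\<^esub>j \<in> {..<1}. c j \<odot>\<^bsub>?Q\<^esub> \<beta> j)"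
      using \<beta> by (simp add: is_left_basis_def)
    moreover have "c \<in> {..<1} \<rightarrow>\<^sub>E U 0 \<and> U i +> x = (\<Oplus>\<^bsub>?Q\<^esub>j \<in> {..<1}. c j \<odot>\<^bsub>?Q\<^esub> \<beta> j) \<longleftrightarrow>
        c \<in> {..<1} \<rightarrow>\<^sub>E U 0 \<and> U i +> x = U i +> c 0 \<otimes> b" for c
      using sum[of c] PiE_mem[of c "{..<1}" "\<lambda>_. U 0" 0] by auto
    ultimately have ex1: "\<exists>!c :: nat \<Rightarrow> 'a. c \<in> {..<1} \<rightarrow>\<^sub>E U 0 \<and> U i +> x = U i +> c 0 \<otimes> b"
      by (simp only:)
    then obtain c :: "nat \<Rightarrow> 'a" where c: "c \<in> {..<1} \<rightarrow>\<^sub>E U 0" "U i +> x = U i +> c 0 \<otimes> b" by blast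
    have uniq: "c' = c" if "c' \<in> {..<1} \<rightarrow>\<^sub>E U 0" "U i +> x = U i +> c' 0 \<otimes> b" for c'
      using ex1 c that by blast
    have c0: "c 0 \<in> U 0" using c(1) by auto
    show ?thesis
    proof (rule ex1I)
      show "c 0 \<in> U 0 \<and> x \<ominus> c 0 \<otimes> b \<in> U i" using c(2) c0 eq_iff[OF x c0] by simp
    next
      fix a assume a: "a \<in> U 0 \<and> x \<ominus> a \<otimes> b \<in> U i"
      \<comment> \<open>Uniqueness is known for coefficient families on the one-element index set,
        so the scalar \<open>a\<close> is turned into such a family.\<close>
      then have "(\<lambda>j\<in>{..<1}. a) = c" using eq_iff[OF x, of a] by (intro uniq) auto
      then show "a = c 0" by auto
    qed
  qed
  then show ?thesis using b(1) by blast
qed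

section \<open>A basis adapted to the filtration\<close>

text \<open>Here \<open>b i\<close> plays the part of a monomial of degree \<open>i\<close>:
  subtracting the right multiple of \<open>b (Suc i)\<close> lowers the degree, and that multiple is
  unique.\<close>

locale filtered_ring_basis = filtered_ring +
  fixes b :: "nat \<Rightarrow> 'a"
  assumes b_0: "b 0 = \<one>"
    and b_Suc: "b (Suc i) \<in> U (Suc i)"
    and lead_coeff: "x \<in> U (Suc i) \<Longrightarrow> \<exists>!a. a \<in> U 0 \<and> x \<ominus> a \<otimes> b (Suc i) \<in> U i"
begin

lemma b_mem: "b i \<in> U i"
  using b_0 b_Suc one_mem by (cases i) auto

lemma term_mem: "\<lbrakk>a \<in> U 0; j \<le> i\<rbrakk> \<Longrightarrow> a \<otimes> b j \<in> U i"
  using mult_mem[OF _ b_mem, of a 0 j] U_mono[of j i] by auto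

lemma term_carrier: "a \<in> U 0 \<Longrightarrow> a \<otimes> b j \<in> carrier R"
  using term_mem[of a j j] carrier_mem by blast

text \<open>Split off the leading term; the remainder lies one step lower in the filtration. With
  uniqueness below, this makes \<open>b 0\<close>, ..., \<open>b i\<close> a basis of
  \<open>U i\<close> over \<open>U 0\<close>.\<close>

lemma expansion_exists:
  "x \<in> U i \<Longrightarrow> \<exists>c. (\<forall>j\<le>i. c j \<in> U 0) \<and> x = (\<Oplus>j\<in>{..i}. c j \<otimes> b j)"
proof (induction i arbitrary: x)
  case 0
  then show ?case using carrier_mem by (intro exI[of _ "\<lambda>_. x"]) (simp add: b_0)
next
  case (Suc i)
  obtain a where a: "a \<in> U 0" "x \<ominus> a \<otimes> b (Suc i) \<in> U i" using lead_coeff[OF Suc.prems] by auto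
  obtain c where c: "\<forall>j\<le>i. c j \<in> U 0" "x \<ominus> a \<otimes> b (Suc i) = (\<Oplus>j\<in>{..i}. c j \<otimes> b j)"
    using Suc.IH[OF a(2)] by auto
  let ?c = "c(Suc i := a)"
  have mem: "?c j \<in> U 0" if "j \<le> Suc i" for j using a c that by auto
  then have cl: "?c j \<otimes> b j \<in> carrier R" if "j \<le> Suc i" for j
    using that term_mem carrier_mem by blast
  have "(\<Oplus>j\<in>{..Suc i}. ?c j \<otimes> b j) = a \<otimes> b (Suc i) \<oplus> (\<Oplus>j\<in>{..i}. ?c j \<otimes> b j)"
    using cl by (subst finsum_Suc) auto
  also have "(\<Oplus>j\<in>{..i}. ?c j \<otimes> b j) = (\<Oplus>j\<in>{..i}. c j \<otimes> b j)"
    using c(1) term_carrier by (intro finsum_cong') auto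
  also have "a \<otimes> b (Suc i) \<oplus> \<dots> = x"
    unfolding c(2)[symmetric] using carrier_mem[OF Suc.prems] cl[of "Suc i"]
    by (simp add: minus_eq a_lcomm r_neg)
  finally have "x = (\<Oplus>j\<in>{..Suc i}. ?c j \<otimes> b j)" ..
  then show ?case using mem by blast
qed

text \<open>Both top coefficients are leading coefficients of the same element, hence equal.
  Cancelling the top terms leaves two equal expansions of lower length.\<close>

lemma expansion_unique:
  assumes "\<And>j. j \<le> i \<Longrightarrow> c j \<in> U 0" "\<And>j. j \<le> i \<Longrightarrow> c' j \<in> U 0"
    and "(\<Oplus>j\<in>{..i}. c j \<otimes> b j) = (\<Oplus>j\<in>{..i}. c' j \<otimes> b j)" and "j \<le> i"
  shows "c j = c' j"
  using assms
proof (induction i arbitrary: j)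
  case 0
  then show ?case using carrier_mem by (simp add: b_0)
next
  case (Suc i)
  let ?x = "\<Oplus>j\<in>{..Suc i}. c j \<otimes> b j"
  have split: "(\<Oplus>j\<in>{..Suc i}. d j \<otimes> b j) = d (Suc i) \<otimes> b (Suc i) \<oplus> (\<Oplus>j\<in>{..i}. d j \<otimes> b j)"
    and low: "(\<Oplus>j\<in>{..i}. d j \<otimes> b j) \<in> U i"
    and all: "(\<Oplus>j\<in>{..Suc i}. d j \<otimes> b j) \<in> U (Suc i)"
    and lead: "d (Suc i) \<otimes> b (Suc i) \<in> carrier R"
    if "\<And>j. j \<le> Suc i \<Longrightarrow> d j \<in> U 0" for d
    using that term_carrier term_mem by (auto intro!: finsum_Suc finsum_mem simp del: finsum_Suc)
  have cancel: "x \<oplus> y \<ominus> x = y" if "x \<in> carrier R" "y \<in> carrier R" for x y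
    using that by (metis a_assoc a_comm a_inv_closed minus_eq r_neg2)
  have diff: "(\<Oplus>j\<in>{..Suc i}. d j \<otimes> b j) \<ominus> d (Suc i) \<otimes> b (Suc i) = (\<Oplus>j\<in>{..i}. d j \<otimes> b j)"
    if d: "\<And>j. j \<le> Suc i \<Longrightarrow> d j \<in> U 0" for d
    by (simp only: split[of d, OF d] cancel[OF lead[of d, OF d] carrier_mem[OF low[of d, OF d]]])
  have "\<exists>!a. a \<in> U 0 \<and> ?x \<ominus> a \<otimes> b (Suc i) \<in> U i"
    by (rule lead_coeff[OF all[of c, OF Suc.prems(1)]])
  moreover have "c (Suc i) \<in> U 0 \<and> ?x \<ominus> c (Suc i) \<otimes> b (Suc i) \<in> U i"
    using diff[of c, OF Suc.prems(1)] low[of c, OF Suc.prems(1)] Suc.prems(1) by simp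
  moreover have "c' (Suc i) \<in> U 0 \<and> ?x \<ominus> c' (Suc i) \<otimes> b (Suc i) \<in> U i"
    unfolding Suc.prems(3)
    using diff[of c', OF Suc.prems(2)] low[of c', OF Suc.prems(2)] Suc.prems(2) by simp
  ultimately have top: "c (Suc i) = c' (Suc i)" by blast
  have "(\<Oplus>j\<in>{..i}. c j \<otimes> b j) = (\<Oplus>j\<in>{..i}. c' j \<otimes> b j)"
    using diff[of c, OF Suc.prems(1)] diff[of c', OF Suc.prems(2)] unfolding Suc.prems(3) top by simp
  then have "c j = c' j" if "j \<le> i" for j
    using Suc.IH[of j] Suc.prems(1,2) that by simp
  then show ?case using top Suc.prems(4) by (auto simp: le_Suc_eq)
qed

section \<open>Descent of matrices from the ring to \<open>U 0\<close>\<close>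

text \<open>The coordinates of \<open>x\<close> in the basis of \<open>U i\<close>. They are
  meaningful only for \<open>x\<close> in \<open>U i\<close> and indices up to
  \<open>i\<close>.\<close>

definition coeffs :: "nat \<Rightarrow> 'a \<Rightarrow> nat \<Rightarrow> 'a" where
  "coeffs i x = (SOME c. (\<forall>j\<le>i. c j \<in> U 0) \<and> x = (\<Oplus>j\<in>{..i}. c j \<otimes> b j))"

lemma coeffs:
  assumes "x \<in> U i"
  shows coeffs_mem: "j \<le> i \<Longrightarrow> coeffs i x j \<in> U 0"
    and coeffs_expansion: "(\<Oplus>j\<in>{..i}. coeffs i x j \<otimes> b j) = x"
  using someI_ex[OF expansion_exists[OF assms]] unfolding coeffs_def[symmetric] by auto

text \<open>The new matrices describe right multiplication by \<open>A\<close> and \<open>B\<close> in the bases \<open>b\<^sub>j\<close>. Only the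
  coordinates \<open>j \<le> d\<close> of the product with \<open>B\<close>, which a priori lies in \<open>U\<^bsub>d+2k\<^esub>\<close>, are retained.\<close>

lemma split_epi_U0:
  fixes m n :: nat
  assumes "split_epi R {..<m} {..<n}"
  shows "\<exists>k. \<forall>d :: nat. split_epi (subring_of R (U 0)) ({..<m} \<times> {..d}) ({..<n} \<times> {..d + k})"
proof -
  obtain A B where *: "\<forall>s\<in>{..<m}. \<forall>t\<in>{..<n}. A s t \<in> carrier R"
    "\<forall>s\<in>{..<m}. \<forall>t\<in>{..<n}. B t s \<in> carrier R"
    "\<forall>s\<in>{..<m}. \<forall>s'\<in>{..<m}. (\<Oplus>t\<in>{..<n}. A s t \<otimes> B t s') = (if s = s' then \<one> else \<zero>)"
    using assms by (rule split_epiE)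
  note A = *(1)[rule_format] and B = *(2)[rule_format] and AB = *(3)[rule_format]
  let ?F = "(\<lambda>(s, t). A s t) ` ({..<m} \<times> {..<n}) \<union> (\<lambda>(s, t). B t s) ` ({..<m} \<times> {..<n})"
  \<comment> \<open>Finitely many entries lie in a common \<open>U k\<close>. This \<open>k\<close>
    is fixed before \<open>d\<close>, so \<open>d\<close> can later be taken large compared with
    it.\<close>
  have "\<exists>k. ?F \<subseteq> U k" by (rule finite_subset_U) (use A B in auto)
  then obtain k where k: "?F \<subseteq> U k" ..
  have AU: "A s t \<in> U k" and BU: "B t s \<in> U k" if "s < m" "t < n" for s t
    using k that by force+
  have "split_epi (subring_of R (U 0)) ({..<m} \<times> {..d}) ({..<n} \<times> {..d + k})" for d
  proof -
    \<comment> \<open>Row \<open>(s, j)\<close> of \<open>P\<close> lists the coordinates of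
      \<open>b j\<close> times row \<open>s\<close> of \<open>A\<close>; row \<open>(t, l)\<close>
      of \<open>Q\<close> does the same for \<open>b l\<close> and row \<open>t\<close> of
      \<open>B\<close>.\<close>
    define P where "P = (\<lambda>(s, j) (t, l). coeffs (d + k) (b j \<otimes> A s t) l)"
    define Q where "Q = (\<lambda>(t, l) (s, j). coeffs (d + k + k) (b l \<otimes> B t s) j)"
    let ?J = "{..<n} \<times> {..d + k}"
    have bA: "b j \<otimes> A s t \<in> U (d + k)" if "s < m" "t < n" "j \<le> d" for s t j
      using mult_mem[OF b_mem AU[OF that(1,2)], of j] U_mono[of "j + k" "d + k"] that by auto
    have bB: "b l \<otimes> B t s \<in> U (d + k + k)" if "s < m" "t < n" "l \<le> d + k" for s t l
      using mult_mem[OF b_mem BU[OF that(1,2)], of l] U_mono[of "l + k" "d + k + k"] that by auto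
    have PU: "P (s, j) (t, l) \<in> U 0" if "s < m" "t < n" "j \<le> d" "l \<le> d + k" for s j t l
      using coeffs_mem[OF bA] that by (simp add: P_def)
    have QU: "Q (t, l) (s, j) \<in> U 0" if "s < m" "t < n" "l \<le> d + k" "j \<le> d + k + k" for s j t l
      using coeffs_mem[OF bB] that by (simp add: Q_def)
    have bc: "b j \<in> carrier R" for j using b_mem carrier_mem by blast
    have PQ: "(\<Oplus>p\<in>?J. P (s, j) p \<otimes> Q p (s', j')) = (if (s, j) = (s', j') then \<one> else \<zero>)"
      if s: "s < m" "s' < m" and j: "j \<le> d" "j' \<le> d" for s s' j j'
    proof -
      \<comment> \<open>The entry is considered for every column index up to
        \<open>d + k + k\<close>, since uniqueness of expansions compares all coordinates at once.
        Only those up to \<open>d\<close> are kept in the end.\<close>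
      let ?e = "\<lambda>j'. \<Oplus>p\<in>?J. P (s, j) p \<otimes> Q p (s', j')"
      let ?\<delta> = "\<lambda>j'. if (s, j) = (s', j') then \<one> else \<zero>"
      have eU: "?e j' \<in> U 0" if "j' \<le> d + k + k" for j'
        using that s j PU QU mult_mem[of _ 0 _ 0] by (intro finsum_mem) auto
      interpret A: additive_subgroup "U 0" R by (rule additive_subgroup)
      have \<delta>U: "?\<delta> j' \<in> U 0" for j' using one_mem by auto
      \<comment> \<open>The entries \<open>?e j'\<close> are the coordinates of component
        \<open>s'\<close> of the row obtained by placing \<open>b j\<close> in position
        \<open>s\<close> and multiplying by \<open>A\<close> and then \<open>B\<close>. As
        \<open>AB = 1\<close>, this component is \<open>b j\<close> or zero, whose coordinates are
        the \<open>?\<delta> j'\<close>.\<close>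
      have "(\<Oplus>j'\<in>{..d + k + k}. ?e j' \<otimes> b j')
          = (\<Oplus>p\<in>?J. P (s, j) p \<otimes> (\<Oplus>j'\<in>{..d + k + k}. Q p (s', j') \<otimes> b j'))"
        using s j PU QU bc carrier_mem by (intro finsum_assoc_matrix[symmetric]) auto
      also have "\<dots> = (\<Oplus>p\<in>?J. case p of (t, l) \<Rightarrow> P (s, j) (t, l) \<otimes> (b l \<otimes> B t s'))"
        using s j PU QU bc B carrier_mem coeffs_expansion[OF bB]
        by (intro finsum_cong') (auto simp: Q_def)
      also have "\<dots> = (\<Oplus>t\<in>{..<n}. \<Oplus>l\<in>{..d + k}. P (s, j) (t, l) \<otimes> (b l \<otimes> B t s'))"
        using s j PU bc B carrier_mem
        by (intro add.finprod_finprod[symmetric]) auto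
      \<comment> \<open>For fixed \<open>t\<close> the inner sum over \<open>l\<close> reassembles
        \<open>b j\<close> times \<open>A s t\<close> from its coordinates, with the factor
        \<open>B t s'\<close> taken out on the right.\<close>
      also have "\<dots> = (\<Oplus>t\<in>{..<n}. b j \<otimes> (A s t \<otimes> B t s'))"
      proof (intro finsum_cong')
        fix t assume t: "t \<in> {..<n}"
        have "(\<Oplus>l\<in>{..d + k}. P (s, j) (t, l) \<otimes> (b l \<otimes> B t s'))
            = (\<Oplus>l\<in>{..d + k}. P (s, j) (t, l) \<otimes> b l \<otimes> B t s')"
          using s j t PU bc B carrier_mem by (intro finsum_cong') (auto simp: m_assoc)
        also have "\<dots> = (\<Oplus>l\<in>{..d + k}. P (s, j) (t, l) \<otimes> b l) \<otimes> B t s'"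
          using s j t PU bc B carrier_mem by (intro finsum_ldistr[symmetric]) auto
        also have "(\<Oplus>l\<in>{..d + k}. P (s, j) (t, l) \<otimes> b l) = b j \<otimes> A s t"
          using coeffs_expansion[OF bA] s j t by (simp add: P_def)
        finally show "(\<Oplus>l\<in>{..d + k}. P (s, j) (t, l) \<otimes> (b l \<otimes> B t s')) = b j \<otimes> (A s t \<otimes> B t s')"
          using s t bc A B by (simp add: m_assoc)
      qed (use s bc A B in auto)
      also have "\<dots> = b j \<otimes> (\<Oplus>t\<in>{..<n}. A s t \<otimes> B t s')"
        using s bc A B by (intro finsum_rdistr[symmetric]) auto
      also have "\<dots> = (if s = s' then b j else \<zero>)"
        using s bc AB by simp
      also have "\<dots> = (\<Oplus>j'\<in>{..d + k + k}. ?\<delta> j' \<otimes> b j')"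
        using finsum_delta_mult[of "{..d + k + k}" j b] j bc by simp
      finally show ?thesis
        using expansion_unique[of "d + k + k" ?e ?\<delta> j'] eU \<delta>U j by simp
    qed
    show ?thesis
    proof (rule split_epiI)
      fix q q' assume q: "q \<in> {..<m} \<times> {..d}" "q' \<in> {..<m} \<times> {..d}"
      then obtain s j s' j' where eq: "q = (s, j)" "q' = (s', j')"
        and less: "s < m" "s' < m" "j \<le> d" "j' \<le> d" by auto
      have "(\<lambda>p. P q p \<otimes> Q p q') \<in> ?J \<rightarrow> U 0"
        using less PU QU mult_mem[of _ 0 _ 0] by (fastforce simp: eq)
      from finsum_subring[OF subring_U0 this]
      show "(\<Oplus>\<^bsub>subring_of R (U 0)\<^esub>p\<in>?J. P q p \<otimes>\<^bsub>subring_of R (U 0)\<^esub> Q p q')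
          = (if q = q' then \<one>\<^bsub>subring_of R (U 0)\<^esub> else \<zero>\<^bsub>subring_of R (U 0)\<^esub>)"
        using PQ[OF less] by (simp add: eq)
    qed (use PU QU in auto)
  qed
  then show ?thesis by blast
qed

end

theorem proposition1p8:
  fixes R :: "('a, 'm) ring_scheme" and U :: "nat \<Rightarrow> 'a set"
  assumes "filtered_ring R U"
    and "\<And>i. left_free_of_rank (subring_of R (U 0))
               (quotient_module (left_mult_module R (U (i + 1))) (U i)) 1"
  shows "rank_condition R \<longleftrightarrow> rank_condition (subring_of R (U 0))"
proof -
  interpret filtered_ring R U by (rule assms(1))
  interpret U0: ring "subring_of R (U 0)" by (rule ring_U0)
  have "\<exists>b \<in> U (Suc i). \<forall>x \<in> U (Suc i). \<exists>!a. a \<in> U 0 \<and> x \<ominus>\<^bsub>R\<^esub> a \<otimes>\<^bsub>R\<^esub> b \<in> U i" for i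
    by (rule quotient_generator[OF assms(2)[of i, unfolded Suc_eq_plus1[symmetric]]])
  then have "\<forall>i. \<exists>b. b \<in> U (Suc i) \<and>
      (\<forall>x \<in> U (Suc i). \<exists>!a. a \<in> U 0 \<and> x \<ominus>\<^bsub>R\<^esub> a \<otimes>\<^bsub>R\<^esub> b \<in> U i)"
    unfolding Bex_def by (rule allI)
  from choice[OF this] obtain g where g: "\<forall>i. g i \<in> U (Suc i) \<and>
      (\<forall>x \<in> U (Suc i). \<exists>!a. a \<in> U 0 \<and> x \<ominus>\<^bsub>R\<^esub> a \<otimes>\<^bsub>R\<^esub> g i \<in> U i)" ..
  \<comment> \<open>The index shifts by one: \<open>g j\<close> generates the factor of
    \<open>U (Suc j)\<close> by \<open>U j\<close>, hence has degree \<open>Suc j\<close>, while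
    degree 0 is spanned by the unit.\<close>
  interpret filtered_ring_basis R U "\<lambda>i. case i of 0 \<Rightarrow> \<one>\<^bsub>R\<^esub> | Suc j \<Rightarrow> g j"
    by (intro_locales, rule filtered_ring_basis_axioms.intro) (simp_all only: nat.case g[rule_format])
  show ?thesis
  proof
    assume R: "rank_condition R"
    show "rank_condition (subring_of R (U 0))"
      unfolding U0.rank_condition_iff_split_epi
    proof (intro allI impI notI)
      fix n :: nat assume n: "n > 0" and "split_epi (subring_of R (U 0)) {..<n + 1} {..<n}"
      then have "split_epi R {..<n + 1} {..<n}" by (intro split_epi_subring[OF subring_U0])
      moreover have "\<not> split_epi R {..<n + 1} {..<n}"
        using R n by (simp only: rank_condition_iff_split_epi not_False_eq_True)
      ultimately show False by contradiction
    qed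
  next
    assume U0: "rank_condition (subring_of R (U 0))"
    show "rank_condition R"
      unfolding rank_condition_iff_split_epi
    proof (intro allI impI notI)
      fix n :: nat assume n: "n > 0" and "split_epi R {..<n + 1} {..<n}"
      then obtain k :: nat where k: "\<And>d :: nat. split_epi (subring_of R (U 0))
          ({..<n + 1} \<times> {..d}) ({..<n} \<times> {..d + k})"
        using split_epi_U0[of "n + 1" n] by blast
      \<comment> \<open>With \<open>d = n * k\<close> the ranks are \<open>n * (d + k + 1)\<close>
        and \<open>(n + 1) * (d + 1)\<close>. The second exceeds the first by
        \<open>d + 1 - n * k\<close>, which is exactly 1 here.\<close>
      have "card ({..<n} \<times> {..n * k + k}) < card ({..<n + 1} \<times> {..n * k})"
        by (simp add: algebra_simps)
      then have "\<not> split_epi (subring_of R (U 0)) ({..<n + 1} \<times> {..n * k}) ({..<n} \<times> {..n * k + k})"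
        using n by (intro U0.rank_condition_not_split_epi[OF U0]) auto
      then show False using k[of "n * k"] by contradiction
    qed
  qed
qed

end
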